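(* Let $u$ be a $W^{1,2}$ map from $S^1$ into $\mathbb{R}^m$ satisfying $$\frac{du}{d\theta}\cdot(-\Delta)^{1/2}u=0\quad\text{a.e. on }S^1 .$$ Then the following identity holds: $$\left|\int_0^{2\pi}u(\theta)\cos\theta\,d\theta\right|^2=\left|\int_0^{2\pi}u(\theta)\sin\theta\,d\theta\right|^2 .$$
   Context: $u(\theta)$ denotes $u(e^{i\theta})$. On $S^1$, $(-\Delta)^{1/2}u=\sum_{n\in\mathbb{Z}}|n|u_ne^{in\theta}$ for $u=\sum_{n\in\mathbb{Z}}u_ne^{in\theta}$; $\cdot$ is the scalar product and $|\cdot|$ the Euclidean norm of $\mathbb{R}^m$. *)

theory Defs
  imports "HOL-Analysis.Analysis"
begin

text \<open>
  A map on the unit circle is a function \<open>f\<close> on the complex numbers of which only the values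
  \<open>f (cis \<theta>)\<close> matter. Integrals over the circle and almost-everywhere statements are taken
  with respect to Lebesgue measure in the angle \<open>\<theta>\<close>.
\<close>

abbreviation angle_measure :: "real measure" where
  "angle_measure \<equiv> lebesgue_on {0..2 * pi}"

definition L2_circle :: "(complex \<Rightarrow> 'a::euclidean_space) \<Rightarrow> bool" where
  "L2_circle f \<longleftrightarrow>
     (\<lambda>\<theta>. f (cis \<theta>)) \<in> borel_measurable angle_measure \<and>
     integrable angle_measure (\<lambda>\<theta>. (norm (f (cis \<theta>)))\<^sup>2)"

definition smooth_circle :: "(complex \<Rightarrow> real) \<Rightarrow> bool" where
  "smooth_circle \<phi> \<longleftrightarrow>
     (\<forall>k \<theta>. ((deriv ^^ k) (\<lambda>t. \<phi> (cis t))) field_differentiable at \<theta>)"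

definition has_weak_deriv_circle ::
    "(complex \<Rightarrow> 'a::euclidean_space) \<Rightarrow> (complex \<Rightarrow> 'a) \<Rightarrow> bool" where
  "has_weak_deriv_circle u v \<longleftrightarrow>
     (\<forall>\<phi>. smooth_circle \<phi> \<longrightarrow>
        (LINT \<theta>|angle_measure. deriv (\<lambda>t. \<phi> (cis t)) \<theta> *\<^sub>R u (cis \<theta>)) =
        - (LINT \<theta>|angle_measure. \<phi> (cis \<theta>) *\<^sub>R v (cis \<theta>)))"

definition W12_circle :: "(complex \<Rightarrow> 'a::euclidean_space) \<Rightarrow> bool" where
  "W12_circle u \<longleftrightarrow> L2_circle u \<and> (\<exists>v. L2_circle v \<and> has_weak_deriv_circle u v)"

text \<open>
  The operators \<open>weak_deriv_circle\<close> and \<open>half_laplacian\<close> below choose a representative of a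
  class of functions modulo equality almost everywhere; on \<open>W\<^sup>1\<^sup>,\<^sup>2\<close> maps a representative exists.
\<close>

definition weak_deriv_circle ::
    "(complex \<Rightarrow> 'a::euclidean_space) \<Rightarrow> complex \<Rightarrow> 'a" where
  "weak_deriv_circle u = (SOME v. L2_circle v \<and> has_weak_deriv_circle u v)"

definition complexify :: "real ^ 'm \<Rightarrow> complex ^ 'm" where
  "complexify x = (\<chi> k. complex_of_real (x $ k))"

definition fourier_coeff :: "(complex \<Rightarrow> real ^ 'm) \<Rightarrow> int \<Rightarrow> complex ^ 'm" where
  "fourier_coeff u n =
     (1 / (2 * pi)) *\<^sub>R
       (LINT \<theta>|angle_measure. cis (- (of_int n * \<theta>)) *s complexify (u (cis \<theta>)))"

text \<open>
  The series \<open>\<Sum>n\<in>\<int>. \<bar>n\<bar> u\<^sub>n e\<^sup>i\<^sup>n\<^sup>\<theta>\<close> is summed in \<open>L\<^sup>2\<close>; its symmetric partial sums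
  are real, and so is its sum.
\<close>

definition has_half_laplacian ::
    "(complex \<Rightarrow> real ^ 'm) \<Rightarrow> (complex \<Rightarrow> real ^ 'm) \<Rightarrow> bool" where
  "has_half_laplacian u w \<longleftrightarrow>
     L2_circle w \<and>
     (\<lambda>N. LINT \<theta>|angle_measure.
        (norm (complexify (w (cis \<theta>)) -
           (\<Sum>n = - int N..int N.
              (of_int \<bar>n\<bar> * cis (of_int n * \<theta>)) *s fourier_coeff u n)))\<^sup>2)
       \<longlonglongrightarrow> 0"

definition half_laplacian :: "(complex \<Rightarrow> real ^ 'm) \<Rightarrow> complex \<Rightarrow> real ^ 'm" where
  "half_laplacian u = (SOME w. has_half_laplacian u w)"

end

theory Submission
  imports Defs
begin

text \<open>
  Write \<open>u\<^sub>n\<close> for the Fourier coefficients of \<open>u\<close>. The derivative has coefficients \<open>\<i> n u\<^sub>n\<close> and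
  the half Laplacian \<open>\<bar>n\<bar> u\<^sub>n\<close>. The product of the two functions vanishes almost everywhere, so all
  its Fourier coefficients vanish; the one at frequency \<open>2\<close> is, up to the factor \<open>\<i>\<close>, the sum of
  \<open>\<bar>k\<bar> (2 - k) u\<^sub>k \<cdot> u\<^sub>2\<^sub>-\<^sub>k\<close> over all integers \<open>k\<close>. Under the exchange of \<open>k\<close> and
  \<open>2 - k\<close> this summand changes sign whenever the two indices have opposite signs, and it vanishes
  when one of them is \<open>0\<close>. Two integers with sum \<open>2\<close> that both are positive are both \<open>1\<close>, so
  the whole sum collapses to \<open>u\<^sub>1 \<cdot> u\<^sub>1\<close> (bilinear, not Hermitian, product). Hence
  \<open>u\<^sub>1 \<cdot> u\<^sub>1 = 0\<close>. Since \<open>2 \<pi> u\<^sub>1 = A - \<i> B\<close> with the cosine integral \<open>A\<close> and the sine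
  integral \<open>B\<close>, the real part of this equation is \<open>\<bar>A\<bar>\<^sup>2 = \<bar>B\<bar>\<^sup>2\<close>.

  The half Laplacian is only an \<open>L\<^sup>2\<close> limit of its symmetric partial sums, so the cancellation is
  carried out for the sum over \<open>-N \<le> k \<le> N\<close> (\<open>weighted_convolution_at_2\<close>). The reflection
  maps this range to \<open>2 - N \<le> k \<le> 2 + N\<close>, which leaves two unpaired summands. They are products of
  coefficients of the derivative at frequencies of size about \<open>N\<close>, and these tend to \<open>0\<close> by
  Bessel's inequality. Pairing with a fixed \<open>L\<^sup>2\<close> function is continuous
  (\<open>tendsto_integral_mult_L2\<close>), so the limit identifies the coefficient of the product
  (\<open>integral_deriv_times_half_laplacian\<close>).

  It remains to know that a half Laplacian exists, so that the chosen representative is one. By Bessel's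
  inequality for the derivative the numbers \<open>\<bar>n\<bar> \<bar>u\<^sub>n\<bar>\<close> are square summable, and the
  completeness of \<open>L\<^sup>2\<close> (\<open>Riesz_Fischer\<close>) gives the limit.
\<close>

section \<open>Square integrable functions and the completeness of \<open>L\<^sup>2\<close>\<close>

definition square_integrable ::
    "'b measure \<Rightarrow> ('b \<Rightarrow> 'a::{banach, second_countable_topology}) \<Rightarrow> bool" where
  "square_integrable M f \<longleftrightarrow>
     f \<in> borel_measurable M \<and> integrable M (\<lambda>x. (norm (f x))\<^sup>2)"

lemma square_integrableD:
  assumes "square_integrable M f"
  shows "f \<in> borel_measurable M" "integrable M (\<lambda>x. (norm (f x))\<^sup>2)"
  using assms by (auto simp: square_integrable_def)

lemma norm_add_power2_le: "(norm (x + y :: 'a::real_normed_vector))\<^sup>2 \<le> 2 * (norm x)\<^sup>2 + 2 * (norm y)\<^sup>2"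
proof -
  have "(norm (x + y))\<^sup>2 \<le> (norm x + norm y)\<^sup>2"
    by (intro power_mono norm_triangle_ineq norm_ge_zero)
  also have "\<dots> \<le> 2 * (norm x)\<^sup>2 + 2 * (norm y)\<^sup>2"
    using sum_squares_bound[of "norm x" "norm y"] by (simp add: power2_sum)
  finally show ?thesis .
qed

lemma square_integrable_bound:
  assumes "square_integrable M f" and "g \<in> borel_measurable M"
    and "\<And>x. x \<in> space M \<Longrightarrow> norm (g x) \<le> norm (f x)"
  shows "square_integrable M g"
  unfolding square_integrable_def
proof
  show "integrable M (\<lambda>x. (norm (g x))\<^sup>2)"
    using assms by (intro Bochner_Integration.integrable_bound[OF square_integrableD(2)[OF assms(1)]])
      (auto intro!: power_mono)
qed (fact assms(2))

lemma square_integrable_add: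
  assumes "square_integrable M f" and "square_integrable M g"
  shows "square_integrable M (\<lambda>x. f x + g x)"
proof -
  note [measurable] = assms[THEN square_integrableD(1)]
  have "integrable M (\<lambda>x. 2 * (norm (f x))\<^sup>2 + 2 * (norm (g x))\<^sup>2)"
    using assms by (auto simp: square_integrable_def)
  then have "integrable M (\<lambda>x. (norm (f x + g x))\<^sup>2)"
    by (rule Bochner_Integration.integrable_bound) (auto intro: norm_add_power2_le)
  then show ?thesis by (simp add: square_integrable_def)
qed

lemma square_integrable_diff:
  assumes "square_integrable M f" and "square_integrable M g"
  shows "square_integrable M (\<lambda>x. f x - g x)"
proof -
  have "square_integrable M (\<lambda>x. - g x)"
    using assms(2) by (auto simp: square_integrable_def)
  from square_integrable_add[OF assms(1) this] show ?thesis by simp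
qed

lemma (in finite_measure) square_integrable_imp_integrable:
  assumes "square_integrable M f"
  shows "integrable M f"
proof -
  have "integrable M (\<lambda>x. 1 + (norm (f x))\<^sup>2)"
    using assms by (auto simp: square_integrable_def)
  then show ?thesis
  proof (rule Bochner_Integration.integrable_bound)
    have "norm (f x) \<le> 1 + (norm (f x))\<^sup>2" for x
      using sum_squares_bound[of 1 "norm (f x)"] norm_ge_zero[of "f x"]
      unfolding one_power2 mult_1_right by linarith
    then show "AE x in M. norm (f x) \<le> norm (1 + (norm (f x))\<^sup>2)"
      by (auto intro!: AE_I2 order_trans[OF _ abs_ge_self])
  qed (use assms in \<open>simp add: square_integrable_def\<close>)
qed

lemma norm_mult_le_half_squares:
  fixes x y :: "'a::real_normed_algebra"
  shows "norm (x * y) \<le> ((norm x)\<^sup>2 + (norm y)\<^sup>2) / 2"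
  using norm_mult_ineq[of x y] sum_squares_bound[of "norm x" "norm y"] by simp

lemma integrable_mult_square_integrable:
  fixes f g :: "'b \<Rightarrow> 'a::{real_normed_algebra, banach, second_countable_topology}"
  assumes "square_integrable M f" and "square_integrable M g"
  shows "integrable M (\<lambda>x. f x * g x)"
proof -
  note [measurable] = assms[THEN square_integrableD(1)]
  have "integrable M (\<lambda>x. ((norm (f x))\<^sup>2 + (norm (g x))\<^sup>2) / 2)"
    using assms by (auto simp: square_integrable_def)
  then show ?thesis
  proof (rule Bochner_Integration.integrable_bound)
    show "AE x in M. norm (f x * g x) \<le> norm (((norm (f x))\<^sup>2 + (norm (g x))\<^sup>2) / 2)"
      by (intro AE_I2 order_trans[OF norm_mult_le_half_squares]) simp
  qed measurable
qed

text \<open>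
  Continuity of the pairing with a fixed \<open>L\<^sup>2\<close> function \<open>f\<close>. Instead of the Cauchy-Schwarz
  inequality, the weighted bound \<open>\<bar>f g\<bar> \<le> (d / 2) \<bar>f\<bar>\<^sup>2 + \<bar>g\<bar>\<^sup>2 / (2 d)\<close> suffices: first \<open>d\<close> is
  chosen small for \<open>f\<close>, then \<open>N\<close> large for \<open>d\<close>.
\<close>

lemma tendsto_integral_mult_L2:
  fixes f :: "'b \<Rightarrow> 'a::{real_normed_field, banach, second_countable_topology}"
  assumes f: "square_integrable M f" and g: "\<And>N. square_integrable M (g N)"
    and lim: "(\<lambda>N. LINT x|M. (norm (g N x))\<^sup>2) \<longlonglongrightarrow> 0"
  shows "(\<lambda>N. LINT x|M. f x * g N x) \<longlonglongrightarrow> 0"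
proof (rule LIMSEQ_I)
  fix e :: real assume e: "e > 0"
  define A where "A = (LINT x|M. (norm (f x))\<^sup>2)"
  have A: "A \<ge> 0" by (simp add: A_def)
  define d where "d = e / (A + 1)"
  have d: "d > 0" using e A by (simp add: d_def)
  have "\<forall>\<^sub>F N in sequentially. (LINT x|M. (norm (g N x))\<^sup>2) < d * e"
    using lim d e by (intro order_tendstoD) auto
  then obtain N0 where N0: "\<And>N. N \<ge> N0 \<Longrightarrow> (LINT x|M. (norm (g N x))\<^sup>2) < d * e"
    by (auto simp: eventually_sequentially)
  have "norm (LINT x|M. f x * g N x) < e" if "N \<ge> N0" for N
  proof -
    \<comment> \<open>from \<open>0 \<le> (d \<bar>f\<bar> - \<bar>g\<bar>)\<^sup>2\<close>; with this \<open>d\<close> each of the two terms integrates to at most \<open>e / 2\<close>\<close>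
    have pt: "norm (f x * g N x) \<le> (d / 2) * (norm (f x))\<^sup>2 + (1 / (2 * d)) * (norm (g N x))\<^sup>2" for x
    proof -
      have "0 \<le> (d * norm (f x) - norm (g N x))\<^sup>2 / (2 * d)" using d by simp
      also have "\<dots> = (d / 2) * (norm (f x))\<^sup>2 + (1 / (2 * d)) * (norm (g N x))\<^sup>2
          - norm (f x) * norm (g N x)"
        using d by (simp add: field_simps power2_eq_square)
      finally show ?thesis by (simp add: norm_mult)
    qed
    have int: "integrable M (\<lambda>x. (d / 2) * (norm (f x))\<^sup>2)"
        "integrable M (\<lambda>x. (1 / (2 * d)) * (norm (g N x))\<^sup>2)"
      using f g[of N] by (auto simp: square_integrable_def)
    have "norm (LINT x|M. f x * g N x) \<le> (LINT x|M. norm (f x * g N x))"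
      by (rule integral_norm_bound)
    also have "\<dots> \<le> (LINT x|M. (d / 2) * (norm (f x))\<^sup>2 + (1 / (2 * d)) * (norm (g N x))\<^sup>2)"
      using int integrable_mult_square_integrable[OF f g[of N]] pt
      by (intro integral_mono) auto
    also have "\<dots> = (d / 2) * A + (1 / (2 * d)) * (LINT x|M. (norm (g N x))\<^sup>2)"
      unfolding A_def by (subst Bochner_Integration.integral_add[OF int]) simp
    also have "\<dots> < (d / 2) * A + (1 / (2 * d)) * (d * e)"
      using N0[OF that] d by (intro add_strict_left_mono mult_strict_left_mono) auto
    also have "\<dots> \<le> e"
    proof -
      have "d * A \<le> e" using A e by (simp add: d_def field_simps)
      then show ?thesis using d by simp
    qed
    finally show ?thesis .
  qed
  then show "\<exists>N0. \<forall>N\<ge>N0. norm ((LINT x|M. f x * g N x) - 0) < e" by auto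
qed

text \<open>
  A subsequence is chosen so sparse that its increments \<open>d\<^sub>k\<close> satisfy \<open>\<integral>\<bar>d\<^sub>k\<bar>\<^sup>2 \<le> 4\<^sup>-\<^sup>k\<close>. Then
  \<open>\<Sum>k. 2\<^sup>k \<bar>d\<^sub>k\<bar>\<^sup>2\<close> has a finite integral and is finite almost everywhere, which makes \<open>\<Sum>k. \<bar>d\<^sub>k\<bar>\<close>
  converge there; the weight \<open>2\<^sup>k\<close> replaces Minkowski's inequality. So the subsequence has an
  almost everywhere limit, and Fatou's lemma turns the Cauchy bounds into bounds for the distance
  to that limit.
\<close>

theorem Riesz_Fischer:
  fixes F :: "nat \<Rightarrow> 'b \<Rightarrow> 'a::{banach, second_countable_topology}"
  assumes F: "\<And>n. square_integrable M (F n)"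
    and cauchy: "\<And>m n. m \<le> n \<Longrightarrow> (LINT x|M. (norm (F n x - F m x))\<^sup>2) \<le> B m"
    and B: "B \<longlonglongrightarrow> 0"
  obtains f where "square_integrable M f" and "(\<lambda>n. LINT x|M. (norm (F n x - f x))\<^sup>2) \<longlonglongrightarrow> 0"
proof -
  have meas [measurable]: "F n \<in> borel_measurable M" for n
    using F[of n] by (rule square_integrableD)
  have int: "integrable M (\<lambda>x. (norm (F n x - F m x))\<^sup>2)" for m n
    by (intro square_integrableD(2) square_integrable_diff F)
  have nn: "(\<integral>\<^sup>+x. ennreal ((norm (F n x - F m x))\<^sup>2) \<partial>M) \<le> ennreal (B m)" if "m \<le> n" for m n
    using cauchy[OF that] int[of n m] by (subst nn_integral_eq_integral) (auto intro: ennreal_leI)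
  have nn': "(\<integral>\<^sup>+x. ennreal ((norm (F m x - F n x))\<^sup>2) \<partial>M) \<le> ennreal (B m)" if "m \<le> n" for m n
    using nn[OF that] by (simp add: norm_minus_commute)
  have "\<exists>N. \<forall>n\<ge>N. B n < (1/4) ^ k" for k
    using order_tendstoD(2)[OF B, of "(1/4) ^ k"] by (auto simp: eventually_sequentially)
  then obtain N where N: "\<And>k n. n \<ge> N k \<Longrightarrow> B n < (1/4) ^ k" by metis
  \<comment> \<open>the partial sums make \<open>r\<close> monotone, and the summand \<open>k\<close> makes it unbounded\<close>
  define r where "r k = (\<Sum>i\<le>k. N i) + k" for k
  have r_ge: "k \<le> r k" for k by (simp add: r_def)
  have r_Suc: "r k \<le> r (Suc k)" for k by (simp add: r_def)
  have B_r: "B (r k) \<le> (1/4) ^ k" for k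
    using N[of k "r k"] member_le_sum[of k "{..k}" N] by (simp add: r_def)
  define d where "d k x = F (r (Suc k)) x - F (r k) x" for k x
  have d_meas [measurable]: "d k \<in> borel_measurable M" for k by (simp add: d_def[abs_def])
  have "(\<integral>\<^sup>+x. (\<Sum>k. ennreal (2 ^ k * (norm (d k x))\<^sup>2)) \<partial>M)
      = (\<Sum>k. \<integral>\<^sup>+x. ennreal (2 ^ k * (norm (d k x))\<^sup>2) \<partial>M)"
    by (rule nn_integral_suminf) simp
  also have "\<dots> \<le> (\<Sum>k. ennreal ((1/2) ^ k))"
  proof (rule suminf_le)
    fix k
    have "(\<integral>\<^sup>+x. ennreal (2 ^ k * (norm (d k x))\<^sup>2) \<partial>M)
        = ennreal (2 ^ k) * (\<integral>\<^sup>+x. ennreal ((norm (d k x))\<^sup>2) \<partial>M)"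
      by (simp add: ennreal_mult nn_integral_cmult)
    also have "\<dots> \<le> ennreal (2 ^ k) * ennreal (B (r k))"
      unfolding d_def using nn[OF r_Suc, of k] by (rule mult_left_mono) simp
    also have "\<dots> \<le> ennreal (2 ^ k) * ennreal ((1/4) ^ k)"
      by (intro mult_left_mono ennreal_leI B_r) simp
    also have "\<dots> = ennreal ((1/2) ^ k)"
      by (simp add: ennreal_mult[symmetric] power_mult_distrib[symmetric])
    finally show "(\<integral>\<^sup>+x. ennreal (2 ^ k * (norm (d k x))\<^sup>2) \<partial>M) \<le> ennreal ((1/2) ^ k)" .
  qed auto
  also have "\<dots> < \<infinity>"
    by (subst suminf_ennreal2) auto
  finally have "AE x in M. (\<Sum>k. ennreal (2 ^ k * (norm (d k x))\<^sup>2)) \<noteq> \<infinity>"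
    by (intro nn_integral_noteq_infinite) auto
  moreover have "convergent (\<lambda>k. F (r k) x)"
    if fin: "(\<Sum>k. ennreal (2 ^ k * (norm (d k x))\<^sup>2)) \<noteq> \<infinity>" for x
  proof -
    have "summable (\<lambda>k. 2 ^ k * (norm (d k x))\<^sup>2)"
      using fin by (intro summable_suminf_not_top) auto
    then have "summable (\<lambda>k. 2 ^ k * (norm (d k x))\<^sup>2 + (1/2) ^ k)"
      by (intro summable_add) auto
    moreover have "norm (d k x) \<le> 2 ^ k * (norm (d k x))\<^sup>2 + (1/2) ^ k" for k
    proof -
      \<comment> \<open>the arithmetic-geometric mean inequality splits \<open>\<bar>d\<^sub>k\<bar>\<close> into two summable terms\<close>
      have "0 \<le> (2 ^ k * norm (d k x) - 1)\<^sup>2 / 2 ^ k" by simp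
      also have "\<dots> = 2 ^ k * (norm (d k x))\<^sup>2 + (1/2) ^ k - 2 * norm (d k x)"
        by (simp add: field_simps power2_eq_square)
      finally show ?thesis using norm_ge_zero[of "d k x"] by linarith
    qed
    ultimately have "summable (\<lambda>k. d k x)"
      by (rule summable_comparison_test'[where N=0])
    then have "convergent (\<lambda>n. F (r 0) x + (\<Sum>k<n. d k x))"
      by (intro convergent_add convergent_const) (simp add: summable_iff_convergent)
    moreover have "F (r 0) x + (\<Sum>k<n. d k x) = F (r n) x" for n
      unfolding d_def using sum_lessThan_telescope[of "\<lambda>k. F (r k) x" n] by simp
    ultimately show ?thesis by simp
  qed
  ultimately have "AE x in M. convergent (\<lambda>k. F (r k) x)" by auto
  define f where "f x = lim (\<lambda>k. F (r k) x)" for x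
  have f_meas [measurable]: "f \<in> borel_measurable M"
    unfolding f_def by measurable
  have lim: "AE x in M. (\<lambda>k. F (r k) x) \<longlonglongrightarrow> f x"
    using \<open>AE x in M. convergent _\<close> unfolding f_def by (simp add: convergent_LIMSEQ_iff)
  have fatou: "(\<integral>\<^sup>+x. ennreal ((norm (F n x - f x))\<^sup>2) \<partial>M) \<le> ennreal (B n)" for n
  proof -
    have "(\<integral>\<^sup>+x. ennreal ((norm (F n x - f x))\<^sup>2) \<partial>M)
        = (\<integral>\<^sup>+x. liminf (\<lambda>k. ennreal ((norm (F n x - F (r k) x))\<^sup>2)) \<partial>M)"
    proof (rule nn_integral_cong_AE)
      show "AE x in M. ennreal ((norm (F n x - f x))\<^sup>2)
          = liminf (\<lambda>k. ennreal ((norm (F n x - F (r k) x))\<^sup>2))"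
        using lim
      proof eventually_elim
        case (elim x)
        then have "(\<lambda>k. ennreal ((norm (F n x - F (r k) x))\<^sup>2)) \<longlonglongrightarrow> ennreal ((norm (F n x - f x))\<^sup>2)"
          by (intro tendsto_intros)
        then show ?case by (intro lim_imp_Liminf[symmetric]) auto
      qed
    qed
    also have "\<dots> \<le> liminf (\<lambda>k. \<integral>\<^sup>+x. ennreal ((norm (F n x - F (r k) x))\<^sup>2) \<partial>M)"
      by (rule nn_integral_liminf) simp
    also have "\<dots> \<le> limsup (\<lambda>k. \<integral>\<^sup>+x. ennreal ((norm (F n x - F (r k) x))\<^sup>2) \<partial>M)"
      by (rule Liminf_le_Limsup) simp
    also have "\<dots> \<le> ennreal (B n)"
    proof (rule Limsup_bounded)
      show "\<forall>\<^sub>F k in sequentially. (\<integral>\<^sup>+x. ennreal ((norm (F n x - F (r k) x))\<^sup>2) \<partial>M) \<le> ennreal (B n)"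
        using eventually_ge_at_top[of n]
      proof eventually_elim
        case (elim k)
        then show ?case using r_ge[of k] by (intro nn') simp
      qed
    qed
    finally show ?thesis .
  qed
  have int_f: "integrable M (\<lambda>x. (norm (F n x - f x))\<^sup>2)" for n
    using fatou[of n] by (intro integrableI_nonneg) (auto simp: le_less_trans)
  have B_nonneg: "0 \<le> B n" for n
    using cauchy[of n n] by simp
  have bound: "(LINT x|M. (norm (F n x - f x))\<^sup>2) \<le> B n" for n
    using fatou[of n] B_nonneg by (subst (asm) nn_integral_eq_integral[OF int_f]) auto
  have "square_integrable M (\<lambda>x. F 0 x - (F 0 x - f x))"
    by (rule square_integrable_diff[OF F]) (simp add: square_integrable_def int_f)
  then have "square_integrable M f" by simp
  moreover have "(\<lambda>n. LINT x|M. (norm (F n x - f x))\<^sup>2) \<longlonglongrightarrow> 0"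
    by (rule tendsto_sandwich[OF _ _ tendsto_const B]) (auto simp: bound)
  ultimately show thesis by (rule that)
qed

section \<open>Fourier coefficients on the circle\<close>

lemma finite_measure_angle_measure: "finite_measure angle_measure"
  by (rule finite_measure_lebesgue_on) simp

lemma continuous_imp_measurable_angle:
  fixes f :: "real \<Rightarrow> 'a::{metric_space, second_countable_topology}"
  assumes "continuous_on UNIV f"
  shows "f \<in> borel_measurable angle_measure"
  by (rule continuous_imp_measurable_on_sets_lebesgue)
    (use assms continuous_on_subset in blast, simp)

lemma measurable_cis_angle [measurable]:
  "(\<lambda>\<theta>. cis (a * \<theta>)) \<in> borel_measurable angle_measure"
  by (intro continuous_imp_measurable_angle continuous_intros)

lemma measurable_cis_minus_angle [measurable]:
  "(\<lambda>\<theta>. cis (- (a * \<theta>))) \<in> borel_measurable angle_measure"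
  by (intro continuous_imp_measurable_angle continuous_intros)

text \<open>
  The orthogonality relations of the characters of the circle.
\<close>

lemma integral_cis_angle:
  "(LINT \<theta>|angle_measure. cis (of_int n * \<theta>)) = (if n = 0 then complex_of_real (2 * pi) else 0)"
proof -
  have "(LINT \<theta>|angle_measure. cis (of_int n * \<theta>)) = integral {0..2*pi} (\<lambda>\<theta>. cis (of_int n * \<theta>))"
    by (intro lebesgue_integral_eq_integral continuous_imp_integrable_real continuous_intros) auto
  also have "\<dots> = (if n = 0 then complex_of_real (2 * pi) else 0)"
  proof (cases "n = 0")
    case True
    then show ?thesis by (simp add: scaleR_conv_of_real)
  next
    case False
    have "((\<lambda>\<theta>. cis (of_int n * \<theta>)) has_integral
        (cis (of_int n * (2 * pi)) / (\<i> * of_int n) - cis (of_int n * 0) / (\<i> * of_int n))) {0..2*pi}"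
    proof (rule fundamental_theorem_of_calculus)
      fix x :: real
      show "((\<lambda>\<theta>. cis (of_int n * \<theta>) / (\<i> * of_int n)) has_vector_derivative cis (of_int n * x))
          (at x within {0..2*pi})"
        unfolding has_vector_derivative_def using False
        by (auto intro!: derivative_eq_intros simp: fun_eq_iff scaleR_conv_of_real)
          (simp add: complex_eq_iff)
    qed simp
    moreover have "cis (of_int n * (2 * pi)) = 1"
      using cis_multiple_2pi[of "of_int n"] by (simp add: mult_ac)
    ultimately show ?thesis using False by (simp add: integral_unique)
  qed
  finally show ?thesis .
qed

definition fourier_coefficient :: "(real \<Rightarrow> complex) \<Rightarrow> int \<Rightarrow> complex" where
  "fourier_coefficient f n =
     (1 / (2 * pi)) *\<^sub>R (LINT \<theta>|angle_measure. cis (- (of_int n * \<theta>)) * f \<theta>)"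

definition trig_poly :: "(int \<Rightarrow> complex) \<Rightarrow> int set \<Rightarrow> real \<Rightarrow> complex" where
  "trig_poly c A \<theta> = (\<Sum>n\<in>A. c n * cis (of_int n * \<theta>))"

lemma measurable_trig_poly [measurable]: "trig_poly c A \<in> borel_measurable angle_measure"
  unfolding trig_poly_def by measurable

lemma square_integrable_trig_poly: "square_integrable angle_measure (trig_poly c A)"
proof -
  interpret finite_measure angle_measure by (rule finite_measure_angle_measure)
  have "norm (trig_poly c A \<theta>) \<le> norm (\<Sum>n\<in>A. norm (c n))" for \<theta>
  proof -
    have "norm (trig_poly c A \<theta>) \<le> (\<Sum>n\<in>A. norm (c n))"
      unfolding trig_poly_def by (rule sum_norm_le) (simp add: norm_mult)
    then show ?thesis by simp
  qed
  then show ?thesis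
    by (rule square_integrable_bound[of _ "\<lambda>_. \<Sum>n\<in>A. norm (c n)", rotated 2])
      (auto simp: square_integrable_def)
qed

lemma square_integrable_cis_mult:
  assumes "square_integrable angle_measure f"
  shows "square_integrable angle_measure (\<lambda>\<theta>. cis (- (a * \<theta>)) * f \<theta>)"
  using square_integrableD(1)[OF assms]
  by (intro square_integrable_bound[OF assms]) (auto simp: norm_mult)

lemma integrable_cis_mult:
  assumes "square_integrable angle_measure f"
  shows "integrable angle_measure (\<lambda>\<theta>. cis (- (a * \<theta>)) * f \<theta>)"
  by (intro finite_measure.square_integrable_imp_integrable finite_measure_angle_measure
      square_integrable_cis_mult assms)

lemma integral_mult_cnj_trig_poly:
  assumes "square_integrable angle_measure f"
  shows "(LINT \<theta>|angle_measure. f \<theta> * cnj (trig_poly c A \<theta>))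
    = 2 * pi * (\<Sum>n\<in>A. cnj (c n) * fourier_coefficient f n)"
proof -
  have "(LINT \<theta>|angle_measure. f \<theta> * cnj (trig_poly c A \<theta>))
      = (LINT \<theta>|angle_measure. (\<Sum>n\<in>A. cnj (c n) * (cis (- (of_int n * \<theta>)) * f \<theta>)))"
    by (simp add: trig_poly_def sum_distrib_left cis_cnj mult_ac)
  also have "\<dots> = (\<Sum>n\<in>A. cnj (c n) * (LINT \<theta>|angle_measure. cis (- (of_int n * \<theta>)) * f \<theta>))"
    by (subst Bochner_Integration.integral_sum) (auto intro: integrable_cis_mult[OF assms])
  finally show ?thesis
    by (simp add: fourier_coefficient_def sum_distrib_left scaleR_conv_of_real)
qed

lemma fourier_coefficient_trig_poly:
  assumes "finite A"
  shows "fourier_coefficient (trig_poly c A) n = (if n \<in> A then c n else 0)"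
proof -
  have "(LINT \<theta>|angle_measure. cis (- (of_int n * \<theta>)) * trig_poly c A \<theta>)
      = (LINT \<theta>|angle_measure. (\<Sum>k\<in>A. c k * cis (of_int (k - n) * \<theta>)))"
    by (simp add: trig_poly_def sum_distrib_left cis_mult mult_ac algebra_simps)
  also have "\<dots> = (\<Sum>k\<in>A. c k * (LINT \<theta>|angle_measure. cis (of_int (k - n) * \<theta>)))"
    by (subst Bochner_Integration.integral_sum)
      (auto intro!: continuous_imp_integrable_real continuous_intros simp del: of_int_diff)
  also have "\<dots> = (\<Sum>k\<in>A. if k = n then 2 * pi * c k else 0)"
    unfolding integral_cis_angle by (intro sum.cong) auto
  also have "\<dots> = (if n \<in> A then 2 * pi * c n else 0)"
    using assms by simp
  finally show ?thesis
    by (simp add: fourier_coefficient_def scaleR_conv_of_real)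
qed

lemma integral_norm_trig_poly:
  assumes "finite A"
  shows "(LINT \<theta>|angle_measure. (norm (trig_poly c A \<theta>))\<^sup>2) = 2 * pi * (\<Sum>n\<in>A. (norm (c n))\<^sup>2)"
proof -
  have "complex_of_real (LINT \<theta>|angle_measure. (norm (trig_poly c A \<theta>))\<^sup>2)
      = (LINT \<theta>|angle_measure. trig_poly c A \<theta> * cnj (trig_poly c A \<theta>))"
    by (subst integral_complex_of_real[symmetric]) (simp only: complex_norm_square)
  also have "\<dots> = complex_of_real (2 * pi * (\<Sum>n\<in>A. (norm (c n))\<^sup>2))"
    unfolding integral_mult_cnj_trig_poly[OF square_integrable_trig_poly] of_real_mult of_real_sum
      complex_norm_square fourier_coefficient_trig_poly[OF assms]
    by (simp add: mult.commute)
  finally show ?thesis unfolding of_real_eq_iff .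
qed

text \<open>
  The squared distance from \<open>f\<close> to its partial Fourier sum is nonnegative, and by orthogonality it
  is the difference of the two sides.
\<close>

lemma Bessel_inequality:
  assumes f: "square_integrable angle_measure f" and "finite A"
  shows "2 * pi * (\<Sum>n\<in>A. (norm (fourier_coefficient f n))\<^sup>2) \<le> (LINT \<theta>|angle_measure. (norm (f \<theta>))\<^sup>2)"
proof -
  let ?T = "trig_poly (fourier_coefficient f) A"
  let ?S = "2 * pi * (\<Sum>n\<in>A. (norm (fourier_coefficient f n))\<^sup>2)"
  have T: "square_integrable angle_measure ?T" by (rule square_integrable_trig_poly)
  have cnjT: "square_integrable angle_measure (\<lambda>\<theta>. cnj (?T \<theta>))"
    by (rule square_integrable_bound[OF T])
      (auto intro: borel_measurable_continuous_on[OF continuous_on_cnj[OF continuous_on_id]])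
  have int: "integrable angle_measure (\<lambda>\<theta>. (norm (f \<theta>))\<^sup>2)"
      "integrable angle_measure (\<lambda>\<theta>. (norm (?T \<theta>))\<^sup>2)"
      "integrable angle_measure (\<lambda>\<theta>. f \<theta> * cnj (?T \<theta>))"
    using f T integrable_mult_square_integrable[OF f cnjT] by (auto simp: square_integrable_def)
  have cross: "(LINT \<theta>|angle_measure. Re (f \<theta> * cnj (?T \<theta>))) = ?S"
  proof -
    have "(LINT \<theta>|angle_measure. f \<theta> * cnj (?T \<theta>)) = complex_of_real ?S"
      unfolding integral_mult_cnj_trig_poly[OF f] of_real_mult of_real_sum complex_norm_square
      by (simp add: mult.commute)
    then show ?thesis
      using integral_Re[OF int(3)] by (simp only: Re_complex_of_real)
  qed
  have "0 \<le> (LINT \<theta>|angle_measure. (norm (f \<theta> - ?T \<theta>))\<^sup>2)" by simp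
  also have "\<dots> = (LINT \<theta>|angle_measure. (norm (f \<theta>))\<^sup>2 + (norm (?T \<theta>))\<^sup>2 - 2 * Re (f \<theta> * cnj (?T \<theta>)))"
    unfolding cmod_power2
    by (intro Bochner_Integration.integral_cong refl) (simp add: power2_eq_square algebra_simps)
  also have "\<dots> = (LINT \<theta>|angle_measure. (norm (f \<theta>))\<^sup>2) + ?S - 2 * ?S"
    using int integral_norm_trig_poly[OF \<open>finite A\<close>] cross integrable_Re[OF int(3)]
    by (simp del: times_complex.sel)
  finally show ?thesis by simp
qed

text \<open>
  The Riemann-Lebesgue lemma for \<open>L\<^sup>2\<close>, a consequence of Bessel's inequality. The injection \<open>h\<close>
  lets the frequency run to \<open>\<infinity>\<close>, to \<open>-\<infinity>\<close>, or along shifted sequences.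
\<close>

lemma fourier_coefficient_tendsto_0:
  assumes "square_integrable angle_measure f" and "inj h"
  shows "(\<lambda>n::nat. fourier_coefficient f (h n)) \<longlonglongrightarrow> 0"
proof -
  have "summable (\<lambda>n. (norm (fourier_coefficient f (h n)))\<^sup>2)"
  proof (rule summableI_nonneg_bounded)
    fix n
    have "(\<Sum>i<n. (norm (fourier_coefficient f (h i)))\<^sup>2)
        = (\<Sum>k\<in>h ` {..<n}. (norm (fourier_coefficient f k))\<^sup>2)"
      using assms(2) by (subst sum.reindex) (auto intro: inj_on_subset)
    also have "\<dots> \<le> (LINT \<theta>|angle_measure. (norm (f \<theta>))\<^sup>2) / (2 * pi)"
      using Bessel_inequality[OF assms(1), of "h ` {..<n}"] by (simp add: field_simps)
    finally show "(\<Sum>i<n. (norm (fourier_coefficient f (h i)))\<^sup>2)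
        \<le> (LINT \<theta>|angle_measure. (norm (f \<theta>))\<^sup>2) / (2 * pi)" .
  qed simp
  then have "(\<lambda>n. (norm (fourier_coefficient f (h n)))\<^sup>2) \<longlonglongrightarrow> 0"
    by (rule summable_LIMSEQ_zero)
  then have "(\<lambda>n. sqrt ((norm (fourier_coefficient f (h n)))\<^sup>2)) \<longlonglongrightarrow> sqrt 0"
    by (intro tendsto_intros)
  then show ?thesis by (simp add: tendsto_norm_zero_iff)
qed

section \<open>The coefficient at frequency 2\<close>

text \<open>
  The algebraic cancellation behind the theorem. The summand \<open>f k = \<bar>k\<bar> (2 - k) a\<^sub>k a\<^sub>2\<^sub>-\<^sub>k\<close> has
  \<open>f k + f (2 - k) = 0\<close> except at \<open>k = 1\<close>, because \<open>k\<close> and \<open>2 - k\<close> otherwise have opposite signs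
  or one of them is \<open>0\<close>. The part of the range that is symmetric about \<open>1\<close> therefore contributes
  \<open>f 1\<close>, and the indices \<open>-N\<close> and \<open>1 - N\<close> remain.
\<close>

lemma weighted_convolution_at_2:
  fixes a :: "int \<Rightarrow> complex"
  assumes "N \<ge> 2"
  shows "(\<Sum>k=-int N..int N. of_int \<bar>k\<bar> * (of_int (2 - k) * (a k * a (2 - k))))
    = (a 1)\<^sup>2 + of_int (int N) * (of_int (2 + int N) * (a (- int N) * a (2 + int N)))
      + of_int (int N - 1) * (of_int (1 + int N) * (a (1 - int N) * a (1 + int N)))"
proof -
  define f where "f k = of_int \<bar>k\<bar> * (of_int (2 - k) * (a k * a (2 - k)))" for k
  have anti: "f k + f (2 - k) = (if k = 1 then 2 * (a 1)\<^sup>2 else 0)" for k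
  proof -
    consider "k \<le> 0" | "k = 1" | "k \<ge> 2" by linarith
    then show ?thesis
      by cases (auto simp: f_def power2_eq_square algebra_simps)
  qed
  have "(\<Sum>k=2 - int N..int N. f k) = (\<Sum>k=2 - int N..int N. f (2 - k))"
    by (rule sum.reindex_bij_witness[of _ "\<lambda>k. 2 - k" "\<lambda>k. 2 - k"]) auto
  then have "2 * (\<Sum>k=2 - int N..int N. f k) = (\<Sum>k=2 - int N..int N. f k + f (2 - k))"
    by (simp add: sum.distrib)
  also have "\<dots> = 2 * (a 1)\<^sup>2"
    unfolding anti using assms by simp
  finally have mid: "(\<Sum>k=2 - int N..int N. f k) = (a 1)\<^sup>2" by simp
  have "{- int N..int N} = insert (- int N) (insert (1 - int N) {2 - int N..int N})"
    using assms by auto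
  then have "(\<Sum>k=-int N..int N. f k) = f (- int N) + (f (1 - int N) + (a 1)\<^sup>2)"
    by (simp add: mid)
  moreover have "f (1 - int N) = of_int (int N - 1) * (of_int (1 + int N) * (a (1 - int N) * a (1 + int N)))"
    using assms by (simp add: f_def algebra_simps)
  moreover have "f (- int N) = of_int (int N) * (of_int (2 + int N) * (a (- int N) * a (2 + int N)))"
    by (simp add: f_def)
  ultimately show ?thesis unfolding f_def by simp
qed

text \<open>
  Here \<open>g\<close> stands for the derivative and \<open>h\<close> for the half Laplacian of \<open>f\<close>. Against a partial sum
  of \<open>h\<close> the integral is the finite sum of \<open>weighted_convolution_at_2\<close>, whose two leftover terms
  are, up to sign, products of coefficients of \<open>g\<close> and tend to \<open>0\<close>.
\<close>

lemma integral_deriv_times_half_laplacian: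
  assumes f: "square_integrable angle_measure f"
    and g: "square_integrable angle_measure g"
    and h: "square_integrable angle_measure h"
    and coeff: "\<And>n. fourier_coefficient g n = \<i> * of_int n * fourier_coefficient f n"
    and lim: "(\<lambda>N. LINT \<theta>|angle_measure. (norm (h \<theta> -
        trig_poly (\<lambda>n. of_int \<bar>n\<bar> * fourier_coefficient f n) {-int N..int N} \<theta>))\<^sup>2) \<longlonglongrightarrow> 0"
  shows "(LINT \<theta>|angle_measure. cis (- (2 * \<theta>)) * (g \<theta> * h \<theta>)) = 2 * pi * \<i> * (fourier_coefficient f 1)\<^sup>2"
proof -
  define a where "a = fourier_coefficient f"
  define T where "T N = trig_poly (\<lambda>n. of_int \<bar>n\<bar> * a n) {-int N..int N}" for N :: nat
  define G where "G \<theta> = cis (- (2 * \<theta>)) * g \<theta>" for \<theta>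
  have G: "square_integrable angle_measure G"
    unfolding G_def by (rule square_integrable_cis_mult[OF g])
  have T: "square_integrable angle_measure (T N)" for N
    unfolding T_def by (rule square_integrable_trig_poly)
  have diff: "square_integrable angle_measure (\<lambda>\<theta>. h \<theta> - T N \<theta>)" for N
    by (intro square_integrable_diff h T)
  have G_coeff: "fourier_coefficient G (- k) = \<i> * of_int (2 - k) * a (2 - k)" for k
  proof -
    have "cis (- (of_int (- k) * \<theta>)) * G \<theta> = cis (- (of_int (2 - k) * \<theta>)) * g \<theta>" for \<theta>
      unfolding G_def mult.assoc[symmetric] cis_mult by (simp add: algebra_simps)
    then have "fourier_coefficient G (- k) = fourier_coefficient g (2 - k)"
      by (simp only: fourier_coefficient_def)
    then show ?thesis by (simp add: coeff a_def)
  qed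
  have GT: "(LINT \<theta>|angle_measure. G \<theta> * T N \<theta>)
      = 2 * pi * \<i> * (\<Sum>k=-int N..int N. of_int \<bar>k\<bar> * (of_int (2 - k) * (a k * a (2 - k))))" for N
  proof -
    \<comment> \<open>the conjugate of a trigonometric polynomial has the conjugate coefficients at the negated frequencies\<close>
    have "T N \<theta> = cnj (trig_poly (\<lambda>n. cnj (of_int \<bar>n\<bar> * a (- n))) {-int N..int N} \<theta>)" for \<theta>
      unfolding T_def trig_poly_def cnj_sum
      by (rule sum.reindex_bij_witness[of _ uminus uminus]) (auto simp: cis_cnj)
    then have "(LINT \<theta>|angle_measure. G \<theta> * T N \<theta>)
        = 2 * pi * (\<Sum>k=-int N..int N. of_int \<bar>k\<bar> * a (- k) * fourier_coefficient G k)"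
      by (simp add: integral_mult_cnj_trig_poly[OF G])
    also have "(\<Sum>k=-int N..int N. of_int \<bar>k\<bar> * a (- k) * fourier_coefficient G k)
        = (\<Sum>k=-int N..int N. of_int \<bar>k\<bar> * a k * fourier_coefficient G (- k))"
      by (rule sum.reindex_bij_witness[of _ uminus uminus]) auto
    finally show ?thesis
      by (simp add: G_coeff sum_distrib_left mult_ac)
  qed
  have lim1: "(\<lambda>N. LINT \<theta>|angle_measure. G \<theta> * (h \<theta> - T N \<theta>)) \<longlonglongrightarrow> 0"
    using lim by (intro tendsto_integral_mult_L2 G diff) (simp add: T_def a_def)
  have "(LINT \<theta>|angle_measure. G \<theta> * (h \<theta> - T N \<theta>))
      = (LINT \<theta>|angle_measure. G \<theta> * h \<theta>) - (LINT \<theta>|angle_measure. G \<theta> * T N \<theta>)" for N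
    using integrable_mult_square_integrable[OF G h] integrable_mult_square_integrable[OF G T]
    by (simp add: right_diff_distrib)
  with lim1 have lim2: "(\<lambda>N. (LINT \<theta>|angle_measure. G \<theta> * h \<theta>) - (LINT \<theta>|angle_measure. G \<theta> * T N \<theta>)) \<longlonglongrightarrow> 0"
    by simp
  have lim3: "(\<lambda>N. LINT \<theta>|angle_measure. G \<theta> * T N \<theta>) \<longlonglongrightarrow> (LINT \<theta>|angle_measure. G \<theta> * h \<theta>)"
    using tendsto_diff[OF tendsto_const[of "LINT \<theta>|angle_measure. G \<theta> * h \<theta>"] lim2] by simp
  define b where "b n = of_int n * a n" for n
  have b_lim: "(\<lambda>n. b (h n)) \<longlonglongrightarrow> 0" if "inj h" for h :: "nat \<Rightarrow> int"
  proof -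
    have "b n = - \<i> * fourier_coefficient g n" for n
      by (simp add: coeff b_def a_def mult.assoc)
    then show ?thesis
      using tendsto_mult_right_zero[OF fourier_coefficient_tendsto_0[OF g that], of "- \<i>"] by simp
  qed
  have "(\<lambda>N. (a 1)\<^sup>2 - b (- int N) * b (2 + int N) - b (1 - int N) * b (1 + int N))
      \<longlonglongrightarrow> (a 1)\<^sup>2 - 0 * 0 - 0 * 0"
    by (intro tendsto_intros b_lim) (auto simp: inj_def)
  then have "(\<lambda>N. (a 1)\<^sup>2 - b (- int N) * b (2 + int N) - b (1 - int N) * b (1 + int N)) \<longlonglongrightarrow> (a 1)\<^sup>2"
    by simp
  then have "(\<lambda>N. \<Sum>k=-int N..int N. of_int \<bar>k\<bar> * (of_int (2 - k) * (a k * a (2 - k)))) \<longlonglongrightarrow> (a 1)\<^sup>2"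
  proof (rule Lim_transform_eventually)
    show "\<forall>\<^sub>F N in sequentially. (a 1)\<^sup>2 - b (- int N) * b (2 + int N) - b (1 - int N) * b (1 + int N)
       = (\<Sum>k=-int N..int N. of_int \<bar>k\<bar> * (of_int (2 - k) * (a k * a (2 - k))))"
      using eventually_ge_at_top[of 2]
      by eventually_elim (subst weighted_convolution_at_2, auto simp: b_def algebra_simps)
  qed
  then have "(\<lambda>N. LINT \<theta>|angle_measure. G \<theta> * T N \<theta>) \<longlonglongrightarrow> 2 * pi * \<i> * (a 1)\<^sup>2"
    unfolding GT by (intro tendsto_intros)
  from LIMSEQ_unique[OF this lim3] show ?thesis
    by (simp add: G_def a_def mult.assoc)
qed

section \<open>Components of vector-valued maps and weak derivatives\<close>

lemma nth_integral:
  assumes "integrable M f"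
  shows "(LINT x|M. f x) $ j = (LINT x|M. f x $ j)"
  using integral_bounded_linear[OF bounded_linear_vec_nth assms, of j] by simp

lemma L2_circle_iff_square_integrable:
  "L2_circle f \<longleftrightarrow> square_integrable angle_measure (\<lambda>\<theta>. f (cis \<theta>))"
  by (simp add: L2_circle_def square_integrable_def)

lemma norm_complexify: "norm (complexify x) = norm x"
  by (simp add: norm_vec_def L2_set_def complexify_def)

lemma bounded_linear_complexify: "bounded_linear complexify"
  by (rule bounded_linear_intro[of _ 1])
    (auto simp: complexify_def vec_eq_iff norm_complexify[unfolded complexify_def] complex_eq_iff)

lemma complexify_diff: "complexify (x - y) = complexify x - complexify y"
  by (simp add: complexify_def vec_eq_iff)

text \<open>
  The components are complexified so that Fourier analysis takes place among scalar functions.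
\<close>

definition complex_component :: "(complex \<Rightarrow> real ^ 'm) \<Rightarrow> 'm \<Rightarrow> real \<Rightarrow> complex" where
  "complex_component f j \<theta> = complex_of_real (f (cis \<theta>) $ j)"

lemma square_integrable_complex_component:
  fixes f :: "complex \<Rightarrow> real ^ 'm"
  assumes "L2_circle f"
  shows "square_integrable angle_measure (complex_component f j)"
proof -
  have f: "square_integrable angle_measure (\<lambda>\<theta>. f (cis \<theta>))"
    using assms by (simp add: L2_circle_iff_square_integrable)
  have "(\<lambda>x. complex_of_real (x $ j)) \<in> borel_measurable borel"
    by (intro borel_measurable_continuous_onI continuous_intros)
  from measurable_compose[OF square_integrableD(1)[OF f] this]
  show ?thesis
    by (intro square_integrable_bound[OF f])
      (auto simp: complex_component_def[abs_def] component_le_norm_cart)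
qed

lemma fourier_coeff_component:
  fixes f :: "complex \<Rightarrow> real ^ 'm"
  assumes "L2_circle f"
  shows "fourier_coeff f n $ j = fourier_coefficient (complex_component f j) n"
proof -
  have f: "square_integrable angle_measure (\<lambda>\<theta>. f (cis \<theta>))"
    using assms by (simp add: L2_circle_iff_square_integrable)
  have "integrable angle_measure (\<lambda>\<theta>. f (cis \<theta>))"
    by (rule finite_measure.square_integrable_imp_integrable[OF finite_measure_angle_measure f])
  then have "integrable angle_measure (\<lambda>\<theta>. complexify (f (cis \<theta>)))"
    by (rule integrable_bounded_linear[OF bounded_linear_complexify])
  then have *: "integrable angle_measure (\<lambda>\<theta>. cis (- (of_int n * \<theta>)) *s complexify (f (cis \<theta>)))"
  proof (rule Bochner_Integration.integrable_bound)
    have "(\<lambda>(z, x::complex ^ 'm). z *s x) \<in> borel_measurable borel"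
      unfolding vector_scalar_mult_def split_def
      by (intro borel_measurable_continuous_onI continuous_intros)
    then have "(\<lambda>\<theta>. (\<lambda>(z, x::complex ^ 'm). z *s x) (cis (- (of_int n * \<theta>)), complexify (f (cis \<theta>))))
        \<in> borel_measurable angle_measure"
      by (rule measurable_compose[rotated])
        (use \<open>integrable angle_measure (\<lambda>\<theta>. complexify (f (cis \<theta>)))\<close> in
          \<open>auto intro!: borel_measurable_Pair\<close>)
    then show "(\<lambda>\<theta>. cis (- (of_int n * \<theta>)) *s complexify (f (cis \<theta>))) \<in> borel_measurable angle_measure"
      by simp
    show "AE \<theta> in angle_measure. norm (cis (- (of_int n * \<theta>)) *s complexify (f (cis \<theta>)))
        \<le> norm (complexify (f (cis \<theta>)))"
      by (simp add: norm_vec_def norm_mult)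
  qed
  show ?thesis
    unfolding fourier_coeff_def fourier_coefficient_def vector_scaleR_component nth_integral[OF *]
    by (simp add: complexify_def complex_component_def)
qed

lemma integrable_cos_sin_mult:
  fixes f :: "real \<Rightarrow> 'a::{banach, second_countable_topology}"
  assumes "integrable angle_measure f"
  shows "integrable angle_measure (\<lambda>\<theta>. cos (a * \<theta>) *\<^sub>R f \<theta>)"
    and "integrable angle_measure (\<lambda>\<theta>. sin (a * \<theta>) *\<^sub>R f \<theta>)"
proof -
  have m: "(\<lambda>\<theta>. cos (a * \<theta>)) \<in> borel_measurable angle_measure"
    "(\<lambda>\<theta>. sin (a * \<theta>)) \<in> borel_measurable angle_measure"
    by (intro continuous_imp_measurable_angle continuous_intros)+
  note [measurable] = m borel_measurable_integrable[OF assms]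
  show "integrable angle_measure (\<lambda>\<theta>. cos (a * \<theta>) *\<^sub>R f \<theta>)"
    by (rule Bochner_Integration.integrable_bound[OF assms]) (auto intro!: mult_left_le_one_le)
  show "integrable angle_measure (\<lambda>\<theta>. sin (a * \<theta>) *\<^sub>R f \<theta>)"
    by (rule Bochner_Integration.integrable_bound[OF assms]) (auto intro!: mult_left_le_one_le)
qed

lemma fourier_coefficient_component_cos_sin:
  assumes "L2_circle f"
  shows "fourier_coefficient (complex_component f j) n = (1 / (2 * pi)) *\<^sub>R
    Complex ((LINT \<theta>|angle_measure. cos (of_int n * \<theta>) *\<^sub>R f (cis \<theta>)) $ j)
      (- (LINT \<theta>|angle_measure. sin (of_int n * \<theta>) *\<^sub>R f (cis \<theta>)) $ j)"
proof -
  have "square_integrable angle_measure (\<lambda>\<theta>. f (cis \<theta>))"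
    using assms by (simp add: L2_circle_iff_square_integrable)
  then have int: "integrable angle_measure (\<lambda>\<theta>. f (cis \<theta>))"
    by (rule finite_measure.square_integrable_imp_integrable[OF finite_measure_angle_measure])
  have cint: "integrable angle_measure (\<lambda>\<theta>. cis (- (of_int n * \<theta>)) * complex_component f j \<theta>)"
    by (intro integrable_cis_mult square_integrable_complex_component assms)
  have "Re (LINT \<theta>|angle_measure. cis (- (of_int n * \<theta>)) * complex_component f j \<theta>)
      = (LINT \<theta>|angle_measure. cos (of_int n * \<theta>) *\<^sub>R f (cis \<theta>)) $ j"
    using integral_Re[OF cint] unfolding nth_integral[OF integrable_cos_sin_mult(1)[OF int]]
    by (simp add: complex_component_def)
  moreover have "Im (LINT \<theta>|angle_measure. cis (- (of_int n * \<theta>)) * complex_component f j \<theta>)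
      = - (LINT \<theta>|angle_measure. sin (of_int n * \<theta>) *\<^sub>R f (cis \<theta>)) $ j"
    using integral_Im[OF cint] unfolding nth_integral[OF integrable_cos_sin_mult(2)[OF int]]
    by (simp add: complex_component_def)
  ultimately show ?thesis
    by (simp add: fourier_coefficient_def complex_eq_iff)
qed

text \<open>
  The span of cosine and sine is closed under differentiation; this is what makes them admissible
  test functions.
\<close>

lemma higher_deriv_cos_sin:
  "\<exists>p q. (deriv ^^ k) (\<lambda>t. a * cos (r * t) + b * sin (r * t)) = (\<lambda>t::real. p * cos (r * t) + q * sin (r * t))"
proof (induction k)
  case (Suc k)
  then obtain p q where pq: "(deriv ^^ k) (\<lambda>t. a * cos (r * t) + b * sin (r * t))
      = (\<lambda>t. p * cos (r * t) + q * sin (r * t))" by blast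
  have "deriv (\<lambda>t. p * cos (r * t) + q * sin (r * t)) t = (q * r) * cos (r * t) + (- p * r) * sin (r * t)" for t
    by (rule DERIV_imp_deriv) (auto intro!: derivative_eq_intros simp: algebra_simps)
  then show ?case unfolding funpow.simps comp_def pq by blast
qed auto

lemma smooth_circle_cos_sin:
  assumes "\<And>t. \<phi> (cis t) = a * cos (r * t) + b * sin (r * t)"
  shows "smooth_circle \<phi>"
  unfolding smooth_circle_def assms
proof (intro allI)
  fix k and \<theta> :: real
  obtain p q where pq: "(deriv ^^ k) (\<lambda>t. a * cos (r * t) + b * sin (r * t))
      = (\<lambda>t. p * cos (r * t) + q * sin (r * t))" using higher_deriv_cos_sin by blast
  show "(deriv ^^ k) (\<lambda>t. a * cos (r * t) + b * sin (r * t)) field_differentiable at \<theta>"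
    unfolding pq field_differentiable_def
    by (rule exI[of _ "- p * r * sin (r * \<theta>) + q * r * cos (r * \<theta>)"])
      (auto intro!: derivative_eq_intros)
qed

text \<open>
  The test functions \<open>cos (n \<theta>)\<close> and \<open>sin (n \<theta>)\<close> are the real and imaginary part of \<open>z\<^sup>n\<close> on the
  circle.
\<close>

lemma fourier_coefficient_weak_deriv:
  assumes u: "L2_circle u" and v: "L2_circle v" and weak: "has_weak_deriv_circle u v"
  shows "fourier_coefficient (complex_component v j) n
    = \<i> * of_int n * fourier_coefficient (complex_component u j) n"
proof -
  have cos: "Re (cis t powi n) = 1 * cos (of_int n * t) + 0 * sin (of_int n * t)" for t
    by (simp add: cis_power_int)
  have sin: "Im (cis t powi n) = 0 * cos (of_int n * t) + 1 * sin (of_int n * t)" for t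
    by (simp add: cis_power_int)
  have dcos: "deriv (\<lambda>t. cos (of_int n * t)) t = - of_int n * sin (of_int n * t)" for t :: real
    by (rule DERIV_imp_deriv) (auto intro!: derivative_eq_intros)
  have dsin: "deriv (\<lambda>t. sin (of_int n * t)) t = of_int n * cos (of_int n * t)" for t :: real
    by (rule DERIV_imp_deriv) (auto intro!: derivative_eq_intros)
  have "(LINT \<theta>|angle_measure. (- of_int n * sin (of_int n * \<theta>)) *\<^sub>R u (cis \<theta>))
      = - (LINT \<theta>|angle_measure. cos (of_int n * \<theta>) *\<^sub>R v (cis \<theta>))"
    using weak[unfolded has_weak_deriv_circle_def, rule_format, OF smooth_circle_cos_sin[OF cos]]
    by (simp add: cos dcos)
  then have 1: "(LINT \<theta>|angle_measure. cos (of_int n * \<theta>) *\<^sub>R v (cis \<theta>))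
      = of_int n *\<^sub>R (LINT \<theta>|angle_measure. sin (of_int n * \<theta>) *\<^sub>R u (cis \<theta>))"
    by (simp flip: scaleR_scaleR)
  have "(LINT \<theta>|angle_measure. (of_int n * cos (of_int n * \<theta>)) *\<^sub>R u (cis \<theta>))
      = - (LINT \<theta>|angle_measure. sin (of_int n * \<theta>) *\<^sub>R v (cis \<theta>))"
    using weak[unfolded has_weak_deriv_circle_def, rule_format, OF smooth_circle_cos_sin[OF sin]]
    by (simp add: sin dsin)
  then have 2: "(LINT \<theta>|angle_measure. sin (of_int n * \<theta>) *\<^sub>R v (cis \<theta>))
      = - of_int n *\<^sub>R (LINT \<theta>|angle_measure. cos (of_int n * \<theta>) *\<^sub>R u (cis \<theta>))"
    by (simp flip: scaleR_scaleR add: minus_equation_iff)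
  show ?thesis
    unfolding fourier_coefficient_component_cos_sin[OF u] fourier_coefficient_component_cos_sin[OF v] 1 2
    by (simp add: complex_eq_iff)
qed

section \<open>Existence of the half Laplacian\<close>

lemma fourier_coefficient_complex_component_minus:
  assumes "L2_circle f"
  shows "fourier_coefficient (complex_component f j) (- n) = cnj (fourier_coefficient (complex_component f j) n)"
  by (simp add: fourier_coefficient_component_cos_sin[OF assms] complex_eq_iff)

text \<open>
  This is what lets the limit be taken among real-valued functions.
\<close>

lemma trig_poly_real:
  assumes "\<And>n. c (- n) = cnj (c n)"
  shows "complex_of_real (Re (trig_poly c {-N..N} \<theta>)) = trig_poly c {-N..N} \<theta>"
proof -
  have "cnj (trig_poly c {-N..N} \<theta>) = trig_poly c {-N..N} \<theta>"
    unfolding trig_poly_def cnj_sum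
    by (rule sum.reindex_bij_witness[of _ uminus uminus]) (auto simp: cis_cnj assms)
  then show ?thesis by (simp add: complex_eq_iff)
qed

text \<open>
  The angles \<open>0\<close> and \<open>2 * pi\<close> name the same point, so a function of the angle descends to the
  circle only after its value at \<open>2 * pi\<close> is changed, which is a change on a null set.
\<close>

lemma circle_function_of_angle_function:
  fixes w :: "real \<Rightarrow> 'a::{second_countable_topology, real_normed_vector}"
  assumes "w \<in> borel_measurable angle_measure"
  obtains w' :: "complex \<Rightarrow> 'a" where "(\<lambda>\<theta>. w' (cis \<theta>)) \<in> borel_measurable angle_measure"
    and "AE \<theta> in angle_measure. w' (cis \<theta>) = w \<theta>"
proof -
  define w' where "w' z = w (Arg2pi z)" for z
  have eq: "w' (cis \<theta>) = (if \<theta> = 2 * pi then w 0 else w \<theta>)" if "\<theta> \<in> space angle_measure" for \<theta>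
  proof (cases "\<theta> = 2 * pi")
    case True
    have "Arg2pi 1 = 0" by (rule Arg2pi_unique[of 1]) auto
    then show ?thesis using True by (simp add: w'_def)
  next
    case False
    then have "Arg2pi (cis \<theta>) = \<theta>" using that
      by (intro Arg2pi_unique[of 1]) (auto simp: cis_conv_exp)
    then show ?thesis using False by (simp add: w'_def)
  qed
  show thesis
  proof (rule that[of w'])
    have "{\<theta> \<in> space angle_measure. \<theta> = 2 * pi} = {2 * pi}" by auto
    then have "{\<theta> \<in> space angle_measure. \<theta> = 2 * pi} \<in> sets angle_measure"
      by (simp only:) (simp add: sets_restrict_space_iff)
    then have "(\<lambda>\<theta>. if \<theta> = 2 * pi then w 0 else w \<theta>) \<in> borel_measurable angle_measure"
      using assms by (intro measurable_If) auto
    then show "(\<lambda>\<theta>. w' (cis \<theta>)) \<in> borel_measurable angle_measure"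
      by (subst measurable_cong[OF eq]) auto
    have "{2 * pi} \<in> null_sets angle_measure"
      by (subst null_sets_restrict_space) auto
    then have "AE \<theta> in angle_measure. \<theta> \<notin> {2 * pi}" by (rule AE_not_in)
    then show "AE \<theta> in angle_measure. w' (cis \<theta>) = w \<theta>"
      using AE_space by eventually_elim (simp add: eq)
  qed
qed

lemma norm_vec_power2: "(norm (x :: 'a::real_normed_vector ^ 'm))\<^sup>2 = (\<Sum>j\<in>UNIV. (norm (x $ j))\<^sup>2)"
  by (simp add: norm_vec_def L2_set_def sum_nonneg)

text \<open>
  The moduli \<open>\<bar>n\<bar> \<bar>u\<^sub>n\<bar>\<close> are those of the coefficients of the weak derivative, hence square summable
  by Bessel's inequality. So the partial sums are Cauchy in \<open>L\<^sup>2\<close>, with the tails of that series as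
  bounds.
\<close>

lemma W12_circle_has_half_laplacian:
  fixes u :: "complex \<Rightarrow> real ^ 'm"
  assumes "W12_circle u"
  shows "\<exists>w. has_half_laplacian u w"
proof -
  obtain v where u: "L2_circle u" and v: "L2_circle v" and weak: "has_weak_deriv_circle u v"
    using assms by (auto simp: W12_circle_def)
  define c where "c j n = of_int \<bar>n\<bar> * fourier_coefficient (complex_component u j) n" for j n
  have norm_c: "norm (c j n) = norm (fourier_coefficient (complex_component v j) n)" for j n
    by (simp add: c_def fourier_coefficient_weak_deriv[OF u v weak] norm_mult)
  have c_minus: "c j (- n) = cnj (c j n)" for j n
    by (simp add: c_def fourier_coefficient_complex_component_minus[OF u])
  define F :: "nat \<Rightarrow> real \<Rightarrow> real ^ 'm"
    where "F N \<theta> = (\<chi> j. Re (trig_poly (c j) {-int N..int N} \<theta>))" for N \<theta>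
  have F_nth: "complex_of_real (F N \<theta> $ j) = trig_poly (c j) {-int N..int N} \<theta>" for N \<theta> j
    unfolding F_def vec_lambda_beta by (rule trig_poly_real) (rule c_minus)
  have F_eq: "complexify (F N \<theta>)
      = (\<Sum>n=-int N..int N. (of_int \<bar>n\<bar> * cis (of_int n * \<theta>)) *s fourier_coeff u n)" for N \<theta>
    by (simp add: vec_eq_iff complexify_def F_nth trig_poly_def c_def fourier_coeff_component[OF u] mult_ac)
  define a where "a N = (\<Sum>j\<in>UNIV. \<Sum>n=-int N..int N. (norm (c j n))\<^sup>2)" for N :: nat
  have norm_diff: "(norm (F n \<theta> - F m \<theta>))\<^sup>2
      = (\<Sum>j\<in>UNIV. (norm (trig_poly (c j) ({-int n..int n} - {-int m..int m}) \<theta>))\<^sup>2)"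
    if "m \<le> n" for m n \<theta>
    unfolding norm_vec_power2
  proof (rule sum.cong)
    fix j
    have "complex_of_real ((F n \<theta> - F m \<theta>) $ j) = trig_poly (c j) ({-int n..int n} - {-int m..int m}) \<theta>"
      using that by (simp add: F_nth trig_poly_def sum_diff)
    then show "(norm ((F n \<theta> - F m \<theta>) $ j))\<^sup>2
        = (norm (trig_poly (c j) ({-int n..int n} - {-int m..int m}) \<theta>))\<^sup>2"
      by (metis norm_of_real real_norm_def)
  qed simp
  have int_diff: "(LINT \<theta>|angle_measure. (norm (F n \<theta> - F m \<theta>))\<^sup>2) = 2 * pi * (a n - a m)"
    if "m \<le> n" for m n
  proof -
    have "(LINT \<theta>|angle_measure. (norm (F n \<theta> - F m \<theta>))\<^sup>2)
      = (\<Sum>j\<in>UNIV. 2 * pi * (\<Sum>k\<in>{-int n..int n} - {-int m..int m}. (norm (c j k))\<^sup>2))"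
      unfolding norm_diff[OF that]
      by (subst Bochner_Integration.integral_sum)
        (auto simp: integral_norm_trig_poly square_integrableD(2)[OF square_integrable_trig_poly])
    also have "\<dots> = 2 * pi * (a n - a m)"
      using that by (simp add: a_def sum_diff sum_subtractf sum_distrib_left right_diff_distrib)
    finally show ?thesis .
  qed
  have F_meas: "F N \<in> borel_measurable angle_measure" for N
    unfolding F_def trig_poly_def
    by (intro continuous_imp_measurable_angle continuous_intros)
  have F: "square_integrable angle_measure (F N)" for N
    unfolding square_integrable_def
  proof
    have "(norm (F N \<theta>))\<^sup>2 = (\<Sum>j\<in>UNIV. (norm (trig_poly (c j) {-int N..int N} \<theta>))\<^sup>2)" for \<theta>
      unfolding norm_vec_power2 by (simp flip: F_nth)
    then show "integrable angle_measure (\<lambda>\<theta>. (norm (F N \<theta>))\<^sup>2)"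
      by (simp add: square_integrableD(2)[OF square_integrable_trig_poly])
  qed (rule F_meas)
  have "incseq a"
    unfolding a_def by (intro monoI sum_mono sum_mono2) auto
  moreover have "a N \<le> (\<Sum>j\<in>UNIV. (LINT \<theta>|angle_measure. (norm (complex_component v j \<theta>))\<^sup>2) / (2 * pi))" for N
    unfolding a_def norm_c
  proof (rule sum_mono)
    fix j
    show "(\<Sum>n=-int N..int N. (norm (fourier_coefficient (complex_component v j) n))\<^sup>2)
        \<le> (LINT \<theta>|angle_measure. (norm (complex_component v j \<theta>))\<^sup>2) / (2 * pi)"
      using Bessel_inequality[OF square_integrable_complex_component[OF v], of "{-int N..int N}" j]
      by (simp add: field_simps)
  qed
  ultimately obtain l where l: "a \<longlonglongrightarrow> l" and le: "\<And>N. a N \<le> l"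
    using incseq_convergent by blast
  have "(\<lambda>m. 2 * pi * (l - a m)) \<longlonglongrightarrow> 2 * pi * (l - l)"
    by (intro tendsto_intros l)
  then have B: "(\<lambda>m. 2 * pi * (l - a m)) \<longlonglongrightarrow> 0" by simp
  have "(LINT \<theta>|angle_measure. (norm (F n \<theta> - F m \<theta>))\<^sup>2) \<le> 2 * pi * (l - a m)" if "m \<le> n" for m n
    unfolding int_diff[OF that] using le[of n] by simp
  from Riesz_Fischer[OF F this B] obtain w where w: "square_integrable angle_measure w"
    and lim: "(\<lambda>n. LINT \<theta>|angle_measure. (norm (F n \<theta> - w \<theta>))\<^sup>2) \<longlonglongrightarrow> 0" by blast
  obtain w' where w'_meas: "(\<lambda>\<theta>. w' (cis \<theta>)) \<in> borel_measurable angle_measure"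
    and AE: "AE \<theta> in angle_measure. w' (cis \<theta>) = w \<theta>"
    using circle_function_of_angle_function[OF square_integrableD(1)[OF w]] by blast
  have "integrable angle_measure (\<lambda>\<theta>. (norm (w' (cis \<theta>)))\<^sup>2)"
  proof (rule Bochner_Integration.integrable_bound[OF square_integrableD(2)[OF w]])
    show "AE \<theta> in angle_measure. norm ((norm (w' (cis \<theta>)))\<^sup>2) \<le> norm ((norm (w \<theta>))\<^sup>2)"
      using AE by eventually_elim simp
  qed (use w'_meas in measurable)
  with w'_meas have "L2_circle w'" by (simp add: L2_circle_def)
  moreover have "(LINT \<theta>|angle_measure. (norm (complexify (w' (cis \<theta>)) - complexify (F N \<theta>)))\<^sup>2)
      = (LINT \<theta>|angle_measure. (norm (F N \<theta> - w \<theta>))\<^sup>2)" for N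
    unfolding complexify_diff[symmetric] norm_complexify
  proof (rule integral_cong_AE)
    show "AE \<theta> in angle_measure. (norm (w' (cis \<theta>) - F N \<theta>))\<^sup>2 = (norm (F N \<theta> - w \<theta>))\<^sup>2"
      using AE by eventually_elim (simp add: norm_minus_commute)
  qed (use w'_meas F_meas[of N] square_integrableD(1)[OF w] in measurable)
  ultimately have "has_half_laplacian u w'"
    unfolding has_half_laplacian_def F_eq[symmetric] using lim by simp
  then show ?thesis by blast
qed

section \<open>The identity for the first Fourier modes\<close>

theorem theorem1p4:
  fixes u :: "complex \<Rightarrow> real ^ 'm"
  assumes "W12_circle u"
    and "AE \<theta> in angle_measure.
           weak_deriv_circle u (cis \<theta>) \<bullet> half_laplacian u (cis \<theta>) = 0"
  shows "(norm (LINT \<theta>|angle_measure. cos \<theta> *\<^sub>R u (cis \<theta>)))\<^sup>2 =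
         (norm (LINT \<theta>|angle_measure. sin \<theta> *\<^sub>R u (cis \<theta>)))\<^sup>2"
proof -
  define v where "v = weak_deriv_circle u"
  define w where "w = half_laplacian u"
  have u: "L2_circle u" using assms(1) by (simp add: W12_circle_def)
  have v: "L2_circle v" and weak: "has_weak_deriv_circle u v"
    using assms(1) someI_ex[of "\<lambda>v. L2_circle v \<and> has_weak_deriv_circle u v"]
    by (auto simp: W12_circle_def v_def weak_deriv_circle_def)
  have half: "has_half_laplacian u w"
    unfolding w_def half_laplacian_def by (rule someI_ex[OF W12_circle_has_half_laplacian[OF assms(1)]])
  then have w: "L2_circle w" by (simp add: has_half_laplacian_def)
  let ?c = "\<lambda>f j. complex_component f j"
  let ?S = "\<lambda>N \<theta>. \<Sum>n=-int N..int N. (of_int \<bar>n\<bar> * cis (of_int n * \<theta>)) *s fourier_coeff u n"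
  have S_nth: "?S N \<theta> $ j = trig_poly (\<lambda>n. of_int \<bar>n\<bar> * fourier_coefficient (?c u j) n) {-int N..int N} \<theta>" for N \<theta> j
    by (simp add: trig_poly_def fourier_coeff_component[OF u] mult_ac)
  have comp: "(LINT \<theta>|angle_measure. cis (- (2 * \<theta>)) * (?c v j \<theta> * ?c w j \<theta>))
      = 2 * pi * \<i> * (fourier_coefficient (?c u j) 1)\<^sup>2" for j
  proof (rule integral_deriv_times_half_laplacian)
    let ?T = "\<lambda>N. trig_poly (\<lambda>n. of_int \<bar>n\<bar> * fourier_coefficient (?c u j) n) {-int N..int N}"
    have sq: "square_integrable angle_measure (\<lambda>\<theta>. ?c w k \<theta> - trig_poly d A \<theta>)" for k d A
      by (intro square_integrable_diff square_integrable_complex_component w square_integrable_trig_poly)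
    have norm_S: "(norm (complexify (w (cis \<theta>)) - ?S N \<theta>))\<^sup>2
        = (\<Sum>k\<in>UNIV. (norm (?c w k \<theta> - trig_poly (\<lambda>n. of_int \<bar>n\<bar> * fourier_coefficient (?c u k) n) {-int N..int N} \<theta>))\<^sup>2)" for N \<theta>
      unfolding norm_vec_power2 vector_minus_component S_nth by (simp add: complexify_def complex_component_def)
    have le: "(LINT \<theta>|angle_measure. (norm (?c w j \<theta> - ?T N \<theta>))\<^sup>2)
        \<le> (LINT \<theta>|angle_measure. (norm (complexify (w (cis \<theta>)) - ?S N \<theta>))\<^sup>2)" for N
      unfolding norm_S
    proof (rule integral_mono)
      show "(norm (?c w j \<theta> - ?T N \<theta>))\<^sup>2 \<le> (\<Sum>k\<in>UNIV. (norm (?c w k \<theta> -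
          trig_poly (\<lambda>n. of_int \<bar>n\<bar> * fourier_coefficient (?c u k) n) {-int N..int N} \<theta>))\<^sup>2)" for \<theta>
        by (rule member_le_sum[of j UNIV "\<lambda>k. (norm (?c w k \<theta> -
          trig_poly (\<lambda>n. of_int \<bar>n\<bar> * fourier_coefficient (?c u k) n) {-int N..int N} \<theta>))\<^sup>2"]) auto
    qed (rule square_integrableD(2)[OF sq] Bochner_Integration.integrable_sum)+
    have "(\<lambda>N. LINT \<theta>|angle_measure. (norm (complexify (w (cis \<theta>)) - ?S N \<theta>))\<^sup>2) \<longlonglongrightarrow> 0"
      using half unfolding has_half_laplacian_def by (rule conjunct2)
    then show "(\<lambda>N. LINT \<theta>|angle_measure. (norm (?c w j \<theta> - ?T N \<theta>))\<^sup>2) \<longlonglongrightarrow> 0"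
      by (rule Lim_null_comparison[OF always_eventually, rotated]) (simp add: le)
  qed (auto intro: square_integrable_complex_component u v w fourier_coefficient_weak_deriv[OF u v weak])
  have int: "integrable angle_measure (\<lambda>\<theta>. cis (- (2 * \<theta>)) * (?c v j \<theta> * ?c w j \<theta>))" for j
    unfolding mult.assoc[symmetric]
    by (intro integrable_mult_square_integrable square_integrable_cis_mult square_integrable_complex_component v w)
  have "2 * pi * \<i> * (\<Sum>j\<in>UNIV. (fourier_coefficient (?c u j) 1)\<^sup>2)
      = (LINT \<theta>|angle_measure. (\<Sum>j\<in>UNIV. cis (- (2 * \<theta>)) * (?c v j \<theta> * ?c w j \<theta>)))"
    by (simp add: Bochner_Integration.integral_sum[OF int] comp sum_distrib_left)
  also have "\<dots> = (LINT \<theta>|angle_measure. cis (- (2 * \<theta>)) * complex_of_real (v (cis \<theta>) \<bullet> w (cis \<theta>)))"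
    by (simp add: inner_vec_def complex_component_def sum_distrib_left)
  also have "\<dots> = 0"
    by (rule integral_eq_zero_AE) (use assms(2) in \<open>eventually_elim, simp add: v_def w_def\<close>)
  finally have "(\<Sum>j\<in>UNIV. (fourier_coefficient (?c u j) 1)\<^sup>2) = 0" by simp
  then have "Re (\<Sum>j\<in>UNIV. (fourier_coefficient (?c u j) 1)\<^sup>2) = 0" by simp
  then have "(\<Sum>j\<in>UNIV. ((LINT \<theta>|angle_measure. cos \<theta> *\<^sub>R u (cis \<theta>)) $ j)\<^sup>2)
      = (\<Sum>j\<in>UNIV. ((LINT \<theta>|angle_measure. sin \<theta> *\<^sub>R u (cis \<theta>)) $ j)\<^sup>2)"
    by (simp add: fourier_coefficient_component_cos_sin[OF u] Re_power2 sum_subtractf flip: sum_distrib_left)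
  then show ?thesis by (simp add: norm_vec_power2)
qed

end
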